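(* Let $\lambda_1,\lambda_2>0$ and let $G=G(n,\lambda_1/n,\lambda_2/n)$. Then for every function $f(n)=o(n)$, with high probability $G$ has no joint component whose number of vertices $k$ satisfies $2<k\le f(n)$.
   Context: A double graph $(V,E_1,E_2)$ consists of a vertex set $V$ with red edges $E_1$ and blue edges $E_2$. $G(n,p_1,p_2)$ is the random double graph on $[n]$ in which each possible red edge is present independently with probability $p_1$ and each possible blue edge independently with probability $p_2$, independently of the red edges. A joint component is a maximal set of vertices that supports both a red spanning tree and a blue spanning tree; the joint components partition the vertex set. "With high probability" means with probability tending to 1 as $n\to\infty$. *)

theory Defs
  imports "HOL-Probability.Probability" "HOL-Library.Landau_Symbols" "HOL-Library.Ramsey"
begin

text \<open>
  Simple undirected graphs: an edge is a two-element set of vertices, so the possible edges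
  on a vertex set \<open>S\<close> are the elements of \<open>[S]\<^bsup>2\<^esup>\<close> (\<^const>\<open>nsets\<close>).
\<close>

definition connected_graph :: "'a set \<Rightarrow> 'a set set \<Rightarrow> bool" where
  "connected_graph S T \<longleftrightarrow>
     S \<noteq> {} \<and> (\<forall>u\<in>S. \<forall>v\<in>S. (u, v) \<in> {(x, y). {x, y} \<in> T}\<^sup>*)"

text \<open>The edge from the last vertex back to the first is the case \<open>Suc i = length c\<close>.\<close>

definition is_cycle :: "'a set set \<Rightarrow> 'a list \<Rightarrow> bool" where
  "is_cycle T c \<longleftrightarrow> 3 \<le> length c \<and> distinct c \<and>
     (\<forall>i<length c. {c ! i, c ! (Suc i mod length c)} \<in> T)"

definition is_tree :: "'a set \<Rightarrow> 'a set set \<Rightarrow> bool" where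
  "is_tree S T \<longleftrightarrow> T \<subseteq> [S]\<^bsup>2\<^esup> \<and> connected_graph S T \<and> (\<nexists>c. is_cycle T c)"

definition supports_spanning_tree :: "'a set set \<Rightarrow> 'a set \<Rightarrow> bool" where
  "supports_spanning_tree E S \<longleftrightarrow> (\<exists>T\<subseteq>E. is_tree S T)"

record 'a double_graph =
  vertices :: "'a set"
  red :: "'a set set"
  blue :: "'a set set"

definition jointly_connected :: "'a double_graph \<Rightarrow> 'a set \<Rightarrow> bool" where
  "jointly_connected G S \<longleftrightarrow> S \<subseteq> vertices G \<and>
     supports_spanning_tree (red G) S \<and> supports_spanning_tree (blue G) S"

definition joint_component :: "'a double_graph \<Rightarrow> 'a set \<Rightarrow> bool" where
  "joint_component G S \<longleftrightarrow>
     jointly_connected G S \<and> (\<forall>S'. jointly_connected G S' \<and> S \<subseteq> S' \<longrightarrow> S' = S)"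

text \<open>
  Note that \<^const>\<open>bernoulli_pmf\<close> truncates its parameter to the interval \<open>[0, 1]\<close>; for
  \<open>p = \<lambda> / n\<close> this affects only finitely many \<open>n\<close>.
\<close>

definition random_edges :: "nat \<Rightarrow> real \<Rightarrow> nat set set pmf" where
  "random_edges n p =
     map_pmf (\<lambda>x. {e \<in> [{1..n}]\<^bsup>2\<^esup>. x e}) (Pi_pmf ([{1..n}]\<^bsup>2\<^esup>) False (\<lambda>_. bernoulli_pmf p))"

definition random_double_graph :: "nat \<Rightarrow> real \<Rightarrow> real \<Rightarrow> nat double_graph pmf" where
  "random_double_graph n p1 p2 =
     map_pmf (\<lambda>(R, B). \<lparr>vertices = {1..n}, red = R, blue = B\<rparr>)
       (pair_pmf (random_edges n p1) (random_edges n p2))"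

end

(* First-moment argument. Rooting a connected graph on k vertices and sending every other vertex to
   a neighbour that is closer to the root gives one of at most k^(k-1) parent maps, whose k-1 edges
   are distinct. Hence a fixed k-set supports a red and a blue spanning tree with probability at most
   (k^2 p1 p2)^(k-1). Since (n choose k) <= (e n / k)^k, the expected number of jointly connected
   k-sets is O((C k / n)^(k-2)), and the sum of this over 3 <= k <= o(n) is O(1/n). *)
theory Submission
  imports Defs
begin

section \<open>Parent maps of rooted connected graphs\<close>

lemma connected_graph_parent_map:
  assumes "connected_graph S T" and TS: "T \<subseteq> [S]\<^bsup>2\<^esup>" and "r \<in> S"
  shows "\<exists>\<pi> \<in> (S - {r}) \<rightarrow>\<^sub>E S. inj_on (\<lambda>v. {v, \<pi> v}) (S - {r}) \<and> (\<forall>v \<in> S - {r}. {v, \<pi> v} \<in> T)"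
proof -
  define R where "R = {(x, y). {x, y} \<in> T}"
  \<comment> \<open>For \<open>v\<close> in \<open>S\<close>, \<open>d v\<close> is the distance
    from the root \<open>r\<close> in the graph \<open>T\<close>.\<close>
  define d where "d v = (LEAST i. (r, v) \<in> R ^^ i)" for v
  have d: "(r, v) \<in> R ^^ d v" if "v \<in> S" for v
  proof -
    have "(r, v) \<in> R\<^sup>*"
      using assms that by (auto simp: connected_graph_def R_def)
    then show ?thesis
      unfolding d_def by (metis LeastI rtrancl_imp_relpow)
  qed
  \<comment> \<open>The parent \<open>u\<close> is the last vertex before \<open>v\<close> on a
    shortest walk from \<open>r\<close>; there is one because only \<open>r\<close> itself is
    reached in zero steps.\<close>
  have "\<exists>u. u \<in> S \<and> {v, u} \<in> T \<and> d u < d v" if v: "v \<in> S - {r}" for v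
  proof -
    have "d v \<noteq> 0"
      using d[of v] v by (metis DiffD1 DiffD2 pair_in_Id_conv relpow.simps(1) singletonI)
    then obtain i where i: "d v = Suc i"
      using not0_implies_Suc by blast
    then obtain u where u: "(r, u) \<in> R ^^ i" "(u, v) \<in> R"
      using d[of v] v by auto
    have "d u \<le> i"
      unfolding d_def using u(1) by (rule Least_le)
    moreover have "{v, u} \<in> T"
      using u(2) by (simp add: R_def insert_commute)
    moreover from this have "u \<in> S"
      using TS by auto
    ultimately show ?thesis
      using i by auto
  qed
  then obtain p where p: "\<And>v. v \<in> S - {r} \<Longrightarrow> p v \<in> S \<and> {v, p v} \<in> T \<and> d (p v) < d v"
    by metis
  have "inj_on (\<lambda>v. {v, restrict p (S - {r}) v}) (S - {r})"
  proof (rule inj_onI)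
    fix v w
    assume vw: "v \<in> S - {r}" "w \<in> S - {r}"
      and eq: "{v, restrict p (S - {r}) v} = {w, restrict p (S - {r}) w}"
    \<comment> \<open>If two vertices were each other's parent, each would be strictly closer to
      \<open>r\<close> than the other.\<close>
    have "v = w \<or> (v = p w \<and> w = p v)"
      using eq vw by (auto simp: doubleton_eq_iff)
    then show "v = w"
      using p[OF vw(1)] p[OF vw(2)] by force
  qed
  then show ?thesis
    by (intro bexI[of _ "restrict p (S - {r})"]) (use p in auto)
qed

section \<open>Probability that a fixed vertex set is jointly connected\<close>

lemma prob_edges_subset_random_edges:
  assumes "A \<subseteq> [{1..n}]\<^bsup>2\<^esup>" and "0 \<le> p"
  shows "measure_pmf.prob (random_edges n p) {E. A \<subseteq> E} \<le> p ^ card A"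
proof -
  let ?N = "[{1..n}]\<^bsup>2\<^esup>"
  have fin: "finite ?N"
    by (simp add: finite_imp_finite_nsets)
  \<comment> \<open>The event is a product set: coordinates in \<open>A\<close> are forced to be
    \<open>True\<close> and all others are free, so the latter contribute factors 1.\<close>
  have "measure_pmf.prob (random_edges n p) {E. A \<subseteq> E}
      = measure_pmf.prob (Pi_pmf ?N False (\<lambda>_. bernoulli_pmf p)) (Pi ?N (\<lambda>e. if e \<in> A then {True} else UNIV))"
    unfolding random_edges_def measure_map_pmf
    by (rule arg_cong[where f = "measure_pmf.prob _"]) (use assms(1) in \<open>auto split: if_splits\<close>)
  also have "\<dots> = (\<Prod>e\<in>?N. measure_pmf.prob (bernoulli_pmf p) (if e \<in> A then {True} else UNIV))"
    using fin by (rule measure_Pi_pmf_Pi)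
  also have "\<dots> = (\<Prod>e\<in>A. measure_pmf.prob (bernoulli_pmf p) {True})"
    by (rule prod.mono_neutral_cong_right) (use fin assms in auto)
  also have "\<dots> = pmf (bernoulli_pmf p) True ^ card A"
    by (simp add: measure_pmf_single)
  also have "\<dots> \<le> p ^ card A"
  proof (rule power_mono)
    \<comment> \<open>For \<open>p > 1\<close> the truncated parameter is 1, so only an inequality
      holds here.\<close>
    show "pmf (bernoulli_pmf p) True \<le> p"
    proof (cases "p \<le> 1")
      case True
      then show ?thesis using assms(2) by simp
    next
      case False
      then show ?thesis by (meson le_cases order_trans pmf_le_1)
    qed
  qed simp
  finally show ?thesis .
qed

text \<open>Union bound over parent maps towards a fixed root. Counting all maps from
  \<open>S - {r}\<close> to \<open>S\<close>, instead of the k^(k-2) trees on k vertices, costs only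
  a factor k and avoids Cayley's formula.\<close>

lemma prob_supports_spanning_tree_le:
  assumes S: "S \<subseteq> {1..n}" "S \<noteq> {}" and "0 \<le> p"
  shows "measure_pmf.prob (random_edges n p) {E. supports_spanning_tree E S}
           \<le> (real (card S) * p) ^ (card S - 1)"
proof -
  obtain r where r: "r \<in> S" using S by auto
  have fin: "finite S" using S finite_subset by blast
  define edges where "edges \<pi> = (\<lambda>v. {v, \<pi> v}) ` (S - {r})" for \<pi> :: "nat \<Rightarrow> nat"
  \<comment> \<open>Injectivity makes the edges of a map number exactly \<open>card S - 1\<close>.
    The inclusion in the set of possible edges rules out fixed points, for which
    \<open>{v, \<pi> v}\<close> is a singleton.\<close>
  define P where "P = {\<pi> \<in> (S - {r}) \<rightarrow>\<^sub>E S. inj_on (\<lambda>v. {v, \<pi> v}) (S - {r}) \<and> edges \<pi> \<subseteq> [{1..n}]\<^bsup>2\<^esup>}"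
  have card_r: "card (S - {r}) = card S - 1"
    using fin r by simp
  have finPE: "finite ((S - {r}) \<rightarrow>\<^sub>E S)"
    using fin by (simp add: finite_PiE)
  then have finP: "finite P"
    unfolding P_def by simp
  have "card P \<le> card ((S - {r}) \<rightarrow>\<^sub>E S)"
    unfolding P_def by (rule card_mono) (use finPE in auto)
  also have "\<dots> = card S ^ (card S - 1)"
    using fin by (simp add: card_PiE card_r)
  finally have cardP: "card P \<le> card S ^ (card S - 1)" .
  have "measure_pmf.prob (random_edges n p) {E. supports_spanning_tree E S}
      \<le> measure_pmf.prob (random_edges n p) (\<Union>\<pi>\<in>P. {E. edges \<pi> \<subseteq> E})"
  proof (rule measure_pmf.finite_measure_mono)
    show "{E. supports_spanning_tree E S} \<subseteq> (\<Union>\<pi>\<in>P. {E. edges \<pi> \<subseteq> E})"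
    proof
      fix E assume "E \<in> {E. supports_spanning_tree E S}"
      then obtain T where T: "T \<subseteq> E" "T \<subseteq> [S]\<^bsup>2\<^esup>" "connected_graph S T"
        unfolding supports_spanning_tree_def is_tree_def by blast
      then obtain \<pi> where \<pi>: "\<pi> \<in> (S - {r}) \<rightarrow>\<^sub>E S" "inj_on (\<lambda>v. {v, \<pi> v}) (S - {r})" "edges \<pi> \<subseteq> T"
        using connected_graph_parent_map[OF T(3) T(2) r] unfolding edges_def image_subset_iff by blast
      moreover have "edges \<pi> \<subseteq> [{1..n}]\<^bsup>2\<^esup>"
        using \<pi>(3) T(2) nsets_mono[OF S(1)] by blast
      ultimately have "\<pi> \<in> P"
        unfolding P_def by blast
      then show "E \<in> (\<Union>\<pi>\<in>P. {E. edges \<pi> \<subseteq> E})"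
        using \<pi>(3) T(1) by blast
    qed
  qed simp
  also have "\<dots> \<le> (\<Sum>\<pi>\<in>P. measure_pmf.prob (random_edges n p) {E. edges \<pi> \<subseteq> E})"
    by (rule measure_pmf.finite_measure_subadditive_finite) (use finP in auto)
  also have "\<dots> \<le> (\<Sum>\<pi>\<in>P. p ^ (card S - 1))"
  proof (rule sum_mono)
    fix \<pi> assume \<pi>: "\<pi> \<in> P"
    then have "card (edges \<pi>) = card S - 1"
      unfolding edges_def using card_r by (simp add: P_def card_image)
    then show "measure_pmf.prob (random_edges n p) {E. edges \<pi> \<subseteq> E} \<le> p ^ (card S - 1)"
      using prob_edges_subset_random_edges[of "edges \<pi>" n p] \<pi> \<open>0 \<le> p\<close> by (auto simp: P_def)
  qed
  also have "\<dots> \<le> real (card S ^ (card S - 1)) * p ^ (card S - 1)"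
    using cardP \<open>0 \<le> p\<close> by (simp add: mult_right_mono del: of_nat_power)
  finally show ?thesis
    by (simp add: power_mult_distrib)
qed

lemma prob_pair_pmf_Times:
  "measure_pmf.prob (pair_pmf M N) (A \<times> B) = measure_pmf.prob M A * measure_pmf.prob N B"
proof -
  \<comment> \<open>\<open>measure_pmf_prob_product\<close> asks for countable sets, so both factors
    are first cut down to the supports.\<close>
  have "measure_pmf.prob (pair_pmf M N) (A \<times> B)
      = measure_pmf.prob (pair_pmf M N) ((A \<inter> set_pmf M) \<times> (B \<inter> set_pmf N))"
    by (metis Times_Int_Times measure_Int_set_pmf set_pair_pmf)
  also have "\<dots> = measure_pmf.prob M (A \<inter> set_pmf M) * measure_pmf.prob N (B \<inter> set_pmf N)"
    by (rule measure_pmf_prob_product) auto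
  finally show ?thesis
    by (simp add: measure_Int_set_pmf)
qed

lemma prob_jointly_connected_le:
  assumes "S \<subseteq> {1..n}" "S \<noteq> {}" "0 \<le> p1" "0 \<le> p2"
  shows "measure_pmf.prob (random_double_graph n p1 p2) {G. jointly_connected G S}
           \<le> (real (card S) * p1) ^ (card S - 1) * (real (card S) * p2) ^ (card S - 1)"
proof -
  have "measure_pmf.prob (random_double_graph n p1 p2) {G. jointly_connected G S}
      = measure_pmf.prob (pair_pmf (random_edges n p1) (random_edges n p2))
          ({E. supports_spanning_tree E S} \<times> {E. supports_spanning_tree E S})"
    unfolding random_double_graph_def measure_map_pmf
    by (rule arg_cong[where f = "measure_pmf.prob _"]) (use assms(1) in \<open>auto simp: jointly_connected_def\<close>)
  also have "\<dots> \<le> (real (card S) * p1) ^ (card S - 1) * (real (card S) * p2) ^ (card S - 1)"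
    unfolding prob_pair_pmf_Times
    by (intro mult_mono prob_supports_spanning_tree_le) (use assms in auto)
  finally show ?thesis .
qed

section \<open>Estimates for the first-moment sum\<close>

lemma power_div_fact_le_exp:
  fixes x :: real
  assumes "0 \<le> x"
  shows "x ^ k / fact k \<le> exp x"
proof -
  \<comment> \<open>A single term of the exponential series is at most its sum, as all terms are
    nonnegative.\<close>
  have "(\<Sum>i\<in>{k}. x ^ i /\<^sub>R fact i) \<le> (\<Sum>i. x ^ i /\<^sub>R fact i)"
    by (rule sum_le_suminf) (use assms summable_exp_generic[of x] in auto)
  then show ?thesis
    by (simp add: exp_def divide_inverse mult.commute)
qed

lemma binomial_le_exp_power:
  assumes "0 < k"
  shows "real (n choose k) \<le> (exp 1 * real n / real k) ^ k"
proof -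
  have "real (n choose k) * fact k \<le> real n ^ k"
    using binomial_fact_pow[of n k] by (metis of_nat_fact of_nat_le_iff of_nat_mult of_nat_power)
  then have "real (n choose k) \<le> real n ^ k / fact k"
    by (simp add: pos_le_divide_eq)
  \<comment> \<open>Splitting off k^k / k! allows the bound by exp k, the case \<open>x = k\<close>
    of the previous lemma.\<close>
  also have "\<dots> = (real n / real k) ^ k * (real k ^ k / fact k)"
    using assms by (simp add: power_divide)
  also have "\<dots> \<le> (real n / real k) ^ k * exp (real k)"
    by (intro mult_left_mono power_div_fact_le_exp) auto
  also have "\<dots> = (exp 1 * real n / real k) ^ k"
    by (simp add: power_mult_distrib power_divide exp_of_nat_mult[symmetric])
  finally show ?thesis .
qed

text \<open>With x = k/n and y = e a b x, the binomial bound turns the term into e^2 a b y^(k-2).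
  One factor y is kept, since it supplies the 1/n; the other k-3 factors are at most 1/2 each, and
  the 8 turns (1/2)^(k-3) into (1/2)^k. For k = 2 no factor y would remain, and with it no decay in
  n.\<close>

lemma first_moment_term_le:
  fixes a b :: real
  assumes "0 < a" "0 < b" "0 < n" "2 < k" and small: "exp 1 * (a * b) * real k \<le> real n / 2"
  shows "real (n choose k) * ((real k * (a / real n)) ^ (k - 1) * (real k * (b / real n)) ^ (k - 1))
           \<le> 8 * exp 1 ^ 3 * (a * b)\<^sup>2 / real n * (real k * (1/2) ^ k)"
proof -
  obtain m where m: "k = m + 3"
    using \<open>2 < k\<close> by (metis add.commute less_iff_Suc_add add_Suc_right numeral_2_eq_2 numeral_3_eq_3 add_Suc)
  define x where "x = real k / real n"
  have x: "0 < x" using assms by (simp add: x_def)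
  have half: "exp 1 * (a * b) * x \<le> 1/2"
    using small \<open>0 < n\<close> by (simp add: x_def field_simps)
  have "real (n choose k) * ((real k * (a / real n)) ^ (k - 1) * (real k * (b / real n)) ^ (k - 1))
      \<le> (exp 1 / x) ^ (m + 3) * ((x * a) ^ (m + 2) * (x * b) ^ (m + 2))"
  proof (rule mult_mono)
    show "real (n choose k) \<le> (exp 1 / x) ^ (m + 3)"
      using binomial_le_exp_power[of k n] \<open>2 < k\<close> by (simp add: x_def m)
  qed (use assms in \<open>auto simp: x_def m\<close>)
  also have "\<dots> = exp 1 ^ 2 * (a * b) * (exp 1 * (a * b) * x) * (exp 1 * (a * b) * x) ^ m"
    using x by (simp add: power_add power_mult_distrib power_divide field_simps eval_nat_numeral)
  also have "\<dots> \<le> exp 1 ^ 2 * (a * b) * (exp 1 * (a * b) * x) * (1/2) ^ m"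
    by (intro mult_left_mono power_mono half) (use assms x in auto)
  also have "\<dots> = 8 * exp 1 ^ 3 * (a * b)\<^sup>2 / real n * (real k * (1/2) ^ k)"
    by (simp add: x_def m power_add eval_nat_numeral)
  finally show ?thesis .
qed

section \<open>Union bound over all sizes, and the limit\<close>

lemma prob_joint_component_le:
  fixes a b x :: real
  assumes "0 < a" "0 < b" "0 < n" and small: "exp 1 * (a * b) * x \<le> real n / 2"
  shows "measure_pmf.prob (random_double_graph n (a / real n) (b / real n))
            {G. \<exists>S. joint_component G S \<and> 2 < card S \<and> real (card S) \<le> x}
         \<le> 8 * exp 1 ^ 3 * (a * b)\<^sup>2 / real n * (\<Sum>k. real k * (1/2) ^ k)"
proof -
  let ?D = "random_double_graph n (a / real n) (b / real n)"
  \<comment> \<open>The condition \<open>k \<le> n\<close> gives finiteness at once and loses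
    nothing, as every relevant \<open>S\<close> lies in \<open>{1..n}\<close>.\<close>
  define K where "K = {k. 2 < k \<and> k \<le> n \<and> real k \<le> x}"
  define sets where "sets k = {S. S \<subseteq> {1..n} \<and> card S = k}" for k
  have finK: "finite K"
    unfolding K_def by (rule finite_subset[of _ "{..n}"]) auto
  have fins: "finite (sets k)" for k
    unfolding sets_def by (rule finite_subset[of _ "Pow {1..n}"]) auto
  \<comment> \<open>Comparison with the differentiated geometric series, whose terms are (k+1)
    (1/2)^k.\<close>
  have summ: "summable (\<lambda>k. real k * (1/2) ^ k :: real)"
    by (rule summable_comparison_test'[OF sums_summable[OF geometric_deriv_sums[of "1/2::real"]]])
       (auto intro: mult_right_mono)
  have supp: "vertices G = {1..n}" if "G \<in> set_pmf ?D" for G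
    using that by (auto simp: random_double_graph_def)
  \<comment> \<open>Only on the support of the random graph is the vertex set known to be
    \<open>{1..n}\<close>.\<close>
  have "measure_pmf.prob ?D {G. \<exists>S. joint_component G S \<and> 2 < card S \<and> real (card S) \<le> x}
      = measure_pmf.prob ?D ({G. \<exists>S. joint_component G S \<and> 2 < card S \<and> real (card S) \<le> x} \<inter> set_pmf ?D)"
    by (rule measure_Int_set_pmf[symmetric])
  also have "\<dots> \<le> measure_pmf.prob ?D (\<Union>k\<in>K. \<Union>S\<in>sets k. {G. jointly_connected G S})"
  proof (rule measure_pmf.finite_measure_mono)
    show "{G. \<exists>S. joint_component G S \<and> 2 < card S \<and> real (card S) \<le> x} \<inter> set_pmf ?D
        \<subseteq> (\<Union>k\<in>K. \<Union>S\<in>sets k. {G. jointly_connected G S})"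
    proof
      fix G assume "G \<in> {G. \<exists>S. joint_component G S \<and> 2 < card S \<and> real (card S) \<le> x} \<inter> set_pmf ?D"
      then obtain S where S: "jointly_connected G S" "2 < card S" "real (card S) \<le> x" "G \<in> set_pmf ?D"
        by (auto simp: joint_component_def)
      then have sub: "S \<subseteq> {1..n}"
        using supp by (simp add: jointly_connected_def)
      then have "card S \<le> n"
        using card_mono[of "{1..n}" S] by simp
      then show "G \<in> (\<Union>k\<in>K. \<Union>S\<in>sets k. {G. jointly_connected G S})"
        using S sub by (auto simp: K_def sets_def)
    qed
  qed simp
  also have "\<dots> \<le> (\<Sum>k\<in>K. measure_pmf.prob ?D (\<Union>S\<in>sets k. {G. jointly_connected G S}))"
    by (rule measure_pmf.finite_measure_subadditive_finite) (use finK in auto)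
  also have "\<dots> \<le> (\<Sum>k\<in>K. 8 * exp 1 ^ 3 * (a * b)\<^sup>2 / real n * (real k * (1/2) ^ k))"
  proof (rule sum_mono)
    fix k assume k: "k \<in> K"
    have "measure_pmf.prob ?D (\<Union>S\<in>sets k. {G. jointly_connected G S})
        \<le> (\<Sum>S\<in>sets k. measure_pmf.prob ?D {G. jointly_connected G S})"
      by (rule measure_pmf.finite_measure_subadditive_finite) (use fins in auto)
    also have "\<dots> \<le> (\<Sum>S\<in>sets k. (real k * (a / real n)) ^ (k - 1) * (real k * (b / real n)) ^ (k - 1))"
    proof (rule sum_mono)
      fix S assume "S \<in> sets k"
      then have "S \<subseteq> {1..n}" "S \<noteq> {}" "card S = k"
        using k by (auto simp: sets_def K_def)
      then show "measure_pmf.prob ?D {G. jointly_connected G S}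
          \<le> (real k * (a / real n)) ^ (k - 1) * (real k * (b / real n)) ^ (k - 1)"
        using prob_jointly_connected_le[of S n "a / real n" "b / real n"] assms by simp
    qed
    also have "\<dots> = real (n choose k) * ((real k * (a / real n)) ^ (k - 1) * (real k * (b / real n)) ^ (k - 1))"
      unfolding sets_def by (simp add: n_subsets)
    also have "\<dots> \<le> 8 * exp 1 ^ 3 * (a * b)\<^sup>2 / real n * (real k * (1/2) ^ k)"
    proof (rule first_moment_term_le)
      have "exp 1 * (a * b) * real k \<le> exp 1 * (a * b) * x"
        by (intro mult_left_mono) (use k assms in \<open>auto simp: K_def\<close>)
      then show "exp 1 * (a * b) * real k \<le> real n / 2"
        using small by linarith
    qed (use assms k in \<open>auto simp: K_def\<close>)
    finally show "measure_pmf.prob ?D (\<Union>S\<in>sets k. {G. jointly_connected G S})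
        \<le> 8 * exp 1 ^ 3 * (a * b)\<^sup>2 / real n * (real k * (1/2) ^ k)" .
  qed
  also have "\<dots> = 8 * exp 1 ^ 3 * (a * b)\<^sup>2 / real n * (\<Sum>k\<in>K. real k * (1/2) ^ k)"
    by (rule sum_distrib_left[symmetric])
  \<comment> \<open>Passing to the whole series leaves a constant that depends neither on
    \<open>n\<close> nor on \<open>x\<close>.\<close>
  also have "\<dots> \<le> 8 * exp 1 ^ 3 * (a * b)\<^sup>2 / real n * (\<Sum>k. real k * (1/2) ^ k)"
    by (intro mult_left_mono sum_le_suminf) (use summ finK in auto)
  finally show ?thesis .
qed

theorem theorem1p2:
  fixes lam1 lam2 :: real and f :: "nat \<Rightarrow> real"
  assumes "lam1 > 0" and "lam2 > 0"
    and "f \<in> o(\<lambda>n. real n)"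
  shows "(\<lambda>n. measure_pmf.prob (random_double_graph n (lam1 / real n) (lam2 / real n))
            {G. \<not> (\<exists>S. joint_component G S \<and> 2 < card S \<and> real (card S) \<le> f n)})
         \<longlonglongrightarrow> 1"
proof -
  let ?D = "\<lambda>n. random_double_graph n (lam1 / real n) (lam2 / real n)"
  let ?B = "\<lambda>n. {G :: nat double_graph. \<exists>S. joint_component G S \<and> 2 < card S \<and> real (card S) \<le> f n}"
  define c where "c = exp 1 * (lam1 * lam2)"
  have c: "0 < c" using assms by (simp add: c_def)
  define M where "M = 8 * exp 1 ^ 3 * (lam1 * lam2)\<^sup>2 * (\<Sum>k. real k * (1/2) ^ k)"
  \<comment> \<open>The constant 1/(2c) in the definition of o(n) is chosen so that
    \<open>c * f n \<le> real n / 2\<close>, which is the smallness hypothesis of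
    \<open>prob_joint_component_le\<close>.\<close>
  have "eventually (\<lambda>n. norm (f n) \<le> 1 / (2 * c) * norm (real n)) sequentially"
    using landau_o.smallD[OF assms(3), of "1 / (2 * c)"] c by simp
  then have "eventually (\<lambda>n. measure_pmf.prob (?D n) (?B n) \<le> M / real n) sequentially"
    using eventually_gt_at_top[of 0]
  proof eventually_elim
    case (elim n)
    then have "f n \<le> 1 / (2 * c) * real n"
      by simp
    then have "c * f n \<le> real n / 2"
      using c by (simp add: field_simps)
    then show ?case
      using prob_joint_component_le[of lam1 lam2 n "f n"] elim assms by (simp add: c_def M_def)
  qed
  \<comment> \<open>The probability is squeezed between 0 and \<open>M / real n\<close>, where
    \<open>M\<close> does not depend on \<open>n\<close>.\<close>
  then have "(\<lambda>n. measure_pmf.prob (?D n) (?B n)) \<longlonglongrightarrow> 0"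
    by (intro tendsto_sandwich[OF _ _ tendsto_const lim_const_over_n[of M]]) auto
  then have "(\<lambda>n. 1 - measure_pmf.prob (?D n) (?B n)) \<longlonglongrightarrow> 1 - 0"
    by (intro tendsto_diff tendsto_const)
  moreover have "measure_pmf.prob (?D n) {G. \<not> (\<exists>S. joint_component G S \<and> 2 < card S \<and> real (card S) \<le> f n)}
      = 1 - measure_pmf.prob (?D n) (?B n)" for n
    using measure_pmf.prob_compl[of "?B n" "?D n"]
    by (simp only: Collect_neg_eq Compl_eq_Diff_UNIV space_measure_pmf sets_measure_pmf UNIV_I)
  ultimately show ?thesis
    by simp
qed

end
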